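(* Let $L$ be a list-assignment of a graph $G$ such that for every vertex $v$ of $G$, $$|L(v)|\;\geq\;4\sum_{w\in N_G(v)}\frac{|L(v)\cap L(w)|}{|L(w)|}.$$ Then there exist at least $\prod_{v\in V(G)}\frac{|L(v)|}{2}$ proper $L$-colourings of $G$.
   Context: Graphs are finite and simple; $N_G(v)$ is the set of neighbours of $v$. A list-assignment $L$ assigns each vertex $v$ a finite nonempty set $L(v)$ of colours. An $L$-colouring is a function $\phi$ with $\phi(v)\in L(v)$ for all $v$; it is proper if adjacent vertices receive different colours. *)

theory Defs
  imports Complex_Main "HOL-Library.FuncSet" "Graph_Theory.Digraph"
begin

text \<open>
  A finite simple graph is a digraph in the locale \<^locale>\<open>graph\<close>: finite, loopless, without
  parallel arcs and symmetric, so that an edge \<open>vw\<close> is a pair of opposite arcs.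
\<close>

definition neighbours :: "('a, 'b) pre_digraph \<Rightarrow> 'a \<Rightarrow> 'a set" where
  "neighbours G v = {w \<in> verts G. v \<rightarrow>\<^bsub>G\<^esub> w}"

definition list_assignment :: "('a, 'b) pre_digraph \<Rightarrow> ('a \<Rightarrow> 'c set) \<Rightarrow> bool" where
  "list_assignment G L \<longleftrightarrow> (\<forall>v \<in> verts G. finite (L v) \<and> L v \<noteq> {})"

text \<open>
  Colourings are extensional (\<^term>\<open>undefined\<close> outside the vertex set), so that two of them
  are equal precisely if they agree on all vertices.
\<close>

definition list_colourings :: "('a, 'b) pre_digraph \<Rightarrow> ('a \<Rightarrow> 'c set) \<Rightarrow> ('a \<Rightarrow> 'c) set" where
  "list_colourings G L = (\<Pi>\<^sub>E v \<in> verts G. L v)"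

definition proper_colouring :: "('a, 'b) pre_digraph \<Rightarrow> ('a \<Rightarrow> 'c) \<Rightarrow> bool" where
  "proper_colouring G \<phi> \<longleftrightarrow> (\<forall>v \<in> verts G. \<forall>w \<in> neighbours G v. \<phi> v \<noteq> \<phi> w)"

end

theory Submission
  imports Defs
begin

text \<open>
  Colour the vertices one at a time: adding a vertex \<open>v\<close> to a set \<open>S\<close> multiplies the number of
  proper colourings by at least \<open>|L v| / 2\<close>. Extend a proper colouring of \<open>S\<close> by any colour of
  \<open>L v\<close>. The extensions that clash at a neighbour \<open>w \<in> S\<close> are determined by a common colour of
  \<open>v\<close> and \<open>w\<close> and a proper colouring of \<open>S - {w}\<close>, and by induction there are at most \<open>2 / |L w|\<close>
  times as many of the latter as of \<open>S\<close>. By hypothesis at most half of the extensions clash.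
\<close>

text \<open>Extensionality off \<open>S\<close> gives every colouring of \<open>S\<close> the value
  \<open>undefined\<close> at other vertices, so restricting to \<open>S - {w}\<close> is an update
  at \<open>w\<close> and the empty set has exactly one colouring.\<close>

definition proper_colourings_on ::
    "('a, 'b) pre_digraph \<Rightarrow> ('a \<Rightarrow> 'c set) \<Rightarrow> 'a set \<Rightarrow> ('a \<Rightarrow> 'c) set" where
  "proper_colourings_on G L S =
    {\<phi> \<in> \<Pi>\<^sub>E v \<in> S. L v. \<forall>v \<in> S. \<forall>w \<in> neighbours G v \<inter> S. \<phi> v \<noteq> \<phi> w}"

lemma proper_colourings_on_verts:
  "proper_colourings_on G L (verts G) = {\<phi> \<in> list_colourings G L. proper_colouring G \<phi>}"
  unfolding proper_colourings_on_def list_colourings_def proper_colouring_def neighbours_def by auto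

lemma proper_colourings_on_empty: "proper_colourings_on G L {} = {\<lambda>_. undefined}"
  unfolding proper_colourings_on_def by auto

lemma finite_proper_colourings_on:
  assumes "finite S" and "\<And>v. v \<in> S \<Longrightarrow> finite (L v)"
  shows "finite (proper_colourings_on G L S)"
  unfolding proper_colourings_on_def using assms by (simp add: finite_PiE)

text \<open>A union bound: a pair of a colour and a colouring either extends to a proper colouring,
  distinct pairs giving distinct extensions, or clashes at some neighbour in
  \<open>S\<close>.\<close>

lemma card_extensions_le:
  assumes G: "graph G" and S: "finite S" "v \<notin> S"
    and L: "\<And>u. u \<in> insert v S \<Longrightarrow> finite (L u)"
  shows "card (L v) * card (proper_colourings_on G L S) \<le>
    card (proper_colourings_on G L (insert v S)) +
    (\<Sum>w \<in> neighbours G v \<inter> S. card {(c, \<phi>) \<in> L v \<times> proper_colourings_on G L S. \<phi> w = c})"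
proof -
  interpret graph G by (fact G)
  have sym: "w \<in> neighbours G v" if "v \<in> neighbours G w" for w
    using that arcs_ends_symmetric[OF sym_arcs, of w v] adj_in_verts(2)[of v w]
    unfolding neighbours_def by blast
  have irrefl: "v \<notin> neighbours G v"
    unfolding neighbours_def using adj_not_same by auto
  define P where "P = L v \<times> proper_colourings_on G L S"
  define clash where "clash w = {(c, \<phi>) \<in> P. \<phi> w = c}" for w
  define good where "good = P - (\<Union>w \<in> neighbours G v \<inter> S. clash w)"
  have fin: "finite P" "finite (proper_colourings_on G L (insert v S))"
    unfolding P_def using S L by (auto intro!: finite_proper_colourings_on)
  \<comment> \<open>Since \<open>v\<close> is not in \<open>S\<close>, \<phi> is
    \<open>undefined\<close> at \<open>v\<close>: the value at \<open>v\<close> returns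
    \<open>c\<close>, and resetting it returns \<phi>.\<close>
  have "inj_on (\<lambda>(c, \<phi>). \<phi>(v := c)) P"
  proof (rule inj_onI, clarsimp)
    fix c \<phi> d \<psi>
    assume "(c, \<phi>) \<in> P" "(d, \<psi>) \<in> P" and eq: "\<phi>(v := c) = \<psi>(v := d)"
    then have "\<phi> v = undefined" "\<psi> v = undefined"
      using S(2) unfolding P_def proper_colourings_on_def by (auto simp: PiE_iff extensional_def)
    with eq show "c = d \<and> \<phi> = \<psi>"
      by (metis fun_upd_eqD fun_upd_triv fun_upd_upd)
  qed
  then have inj: "inj_on (\<lambda>(c, \<phi>). \<phi>(v := c)) good"
    by (rule inj_on_subset) (auto simp: good_def)
  have "(\<lambda>(c, \<phi>). \<phi>(v := c)) ` good \<subseteq> proper_colourings_on G L (insert v S)"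
  proof clarify
    fix c \<phi>
    assume g: "(c, \<phi>) \<in> good"
    then have c: "c \<in> L v" and col: "\<phi> \<in> (\<Pi>\<^sub>E v \<in> S. L v)"
      and proper: "\<And>x y. x \<in> S \<Longrightarrow> y \<in> neighbours G x \<inter> S \<Longrightarrow> \<phi> x \<noteq> \<phi> y"
      and ne: "\<And>w. w \<in> neighbours G v \<inter> S \<Longrightarrow> \<phi> w \<noteq> c"
      unfolding good_def clash_def P_def proper_colourings_on_def by auto
    have "\<phi>(v := c) \<in> (\<Pi>\<^sub>E v \<in> insert v S. L v)"
      using c col by (rule PiE_fun_upd)
    moreover have "(\<phi>(v := c)) x \<noteq> (\<phi>(v := c)) y"
      if "x \<in> insert v S" "y \<in> neighbours G x \<inter> insert v S" for x y
      \<comment> \<open>Properness ranges over ordered pairs: \<open>irrefl\<close> excludes x = y =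
        v, and \<open>sym\<close> reduces y = v to a neighbour x of v.\<close>
      using that irrefl proper[of x y] ne[of y] ne[of x] sym[of x] by auto
    ultimately show "\<phi>(v := c) \<in> proper_colourings_on G L (insert v S)"
      unfolding proper_colourings_on_def by blast
  qed
  then have "card good \<le> card (proper_colourings_on G L (insert v S))"
    using card_inj_on_le[OF inj] fin by blast
  moreover have "card P \<le> card good + card (\<Union>w \<in> neighbours G v \<inter> S. clash w)"
  proof -
    have "finite good" "finite (\<Union>w \<in> neighbours G v \<inter> S. clash w)"
      using fin S by (auto simp: good_def clash_def intro: finite_subset[OF _ fin(1)])
    moreover have "P \<subseteq> good \<union> (\<Union>w \<in> neighbours G v \<inter> S. clash w)"
      by (auto simp: good_def)
    ultimately show ?thesis
      by (meson card_Un_le card_mono finite_UnI le_trans)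
  qed
  moreover have "card (\<Union>w \<in> neighbours G v \<inter> S. clash w) \<le> (\<Sum>w \<in> neighbours G v \<inter> S. card (clash w))"
    using S by (intro card_UN_le) auto
  moreover have "card P = card (L v) * card (proper_colourings_on G L S)"
    by (simp add: P_def card_cartesian_product)
  ultimately show ?thesis
    unfolding clash_def P_def by linarith
qed

text \<open>In a clash the colour at \<open>w\<close> is \<open>c\<close> itself, so it lies in both
  lists, and \<phi> is recovered from \<open>c\<close> and its restriction to
  \<open>S - {w}\<close>.\<close>

lemma card_clashes_le:
  assumes S: "finite S" "w \<in> S" and L: "\<And>u. u \<in> S \<Longrightarrow> finite (L u)"
  shows "card {(c, \<phi>) \<in> L v \<times> proper_colourings_on G L S. \<phi> w = c}
    \<le> card (L v \<inter> L w) * card (proper_colourings_on G L (S - {w}))"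
proof -
  let ?C = "{(c, \<phi>) \<in> L v \<times> proper_colourings_on G L S. \<phi> w = c}"
  let ?f = "\<lambda>(c, \<phi>). (c, \<phi>(w := undefined))"
  have "inj_on ?f ?C"
    by (rule inj_onI) (clarsimp, metis fun_upd_triv fun_upd_upd)
  moreover have "?f ` ?C \<subseteq> (L v \<inter> L w) \<times> proper_colourings_on G L (S - {w})"
    using S(2) unfolding proper_colourings_on_def
    by (auto simp: PiE_iff extensional_def split: if_splits)
  moreover have "finite ((L v \<inter> L w) \<times> proper_colourings_on G L (S - {w}))"
    using S L by (auto intro!: finite_proper_colourings_on)
  ultimately have "card ?C \<le> card ((L v \<inter> L w) \<times> proper_colourings_on G L (S - {w}))"
    by (rule card_inj_on_le)
  then show ?thesis
    by (simp add: card_cartesian_product)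
qed

text \<open>The induction is on the size of \<open>S\<close> with \<open>S\<close> and
  \<open>v\<close> both arbitrary, because bounding the clashes at \<open>w\<close> requires the
  claim for adding \<open>w\<close> to \<open>S - {w}\<close>.\<close>

lemma card_proper_colourings_on_insert:
  fixes G :: "('a, 'b) pre_digraph" and L :: "'a \<Rightarrow> 'c set"
  assumes G: "graph G" and L: "list_assignment G L"
    and sparse: "\<And>v. v \<in> verts G \<Longrightarrow>
      real (card (L v)) \<ge>
        4 * (\<Sum>w \<in> neighbours G v. real (card (L v \<inter> L w)) / real (card (L w)))"
    and "S \<subseteq> verts G" "v \<in> verts G" "v \<notin> S"
  shows "real (card (L v)) / 2 * card (proper_colourings_on G L S)
    \<le> card (proper_colourings_on G L (insert v S))"
  using assms(4-)
proof (induction "card S" arbitrary: S v rule: less_induct)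
  case less
  interpret graph G by (fact G)
  let ?n = "\<lambda>S. real (card (proper_colourings_on G L S))"
  let ?N = "neighbours G v \<inter> S"
  have finL: "finite (L u)" and posL: "card (L u) > 0" if "u \<in> verts G" for u
    using L that unfolding list_assignment_def by (auto simp: card_gt_0_iff)
  have finS: "finite S"
    using less.prems(1) finite_verts by (rule finite_subset)
  have finN: "finite (neighbours G v)"
    unfolding neighbours_def by simp
  have clash: "real (card {(c, \<phi>) \<in> L v \<times> proper_colourings_on G L S. \<phi> w = c})
      \<le> 2 * ?n S * (real (card (L v \<inter> L w)) / real (card (L w)))" if w: "w \<in> ?N" for w
  proof -
    have wV: "w \<in> verts G"
      using w less.prems(1) by auto
    have "real (card (L w)) / 2 * ?n (S - {w}) \<le> ?n (insert w (S - {w}))"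
      using w wV less.prems(1) finS by (intro less.hyps) (auto simp: card_gt_0_iff intro!: diff_less)
    \<comment> \<open>Putting \<open>w\<close> back restores \<open>S\<close>; the division is sound
      as lists are nonempty.\<close>
    then have "?n (S - {w}) \<le> 2 * ?n S / real (card (L w))"
      using w posL[OF wV] by (simp add: insert_absorb field_simps)
    then have "real (card (L v \<inter> L w)) * ?n (S - {w})
        \<le> real (card (L v \<inter> L w)) * (2 * ?n S / real (card (L w)))"
      by (rule mult_left_mono) simp
    moreover have "real (card {(c, \<phi>) \<in> L v \<times> proper_colourings_on G L S. \<phi> w = c})
        \<le> real (card (L v \<inter> L w) * card (proper_colourings_on G L (S - {w})))"
      using w finS less.prems(1) finL by (intro of_nat_mono card_clashes_le) auto
    ultimately show ?thesis
      by (simp add: field_simps)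
  qed
  have "(\<Sum>w \<in> ?N. real (card {(c, \<phi>) \<in> L v \<times> proper_colourings_on G L S. \<phi> w = c}))
      \<le> 2 * ?n S * (\<Sum>w \<in> ?N. real (card (L v \<inter> L w)) / real (card (L w)))"
    unfolding sum_distrib_left using clash by (rule sum_mono)
  also have "\<dots> \<le> 2 * ?n S * (\<Sum>w \<in> neighbours G v. real (card (L v \<inter> L w)) / real (card (L w)))"
    using finN by (intro mult_left_mono sum_mono2) auto
  \<comment> \<open>Here the constant 4 enters: it absorbs the factor 2 from the induction
    hypothesis and still leaves at most half of all pairs clashing.\<close>
  also have "\<dots> \<le> 2 * ?n S * (real (card (L v)) / 4)"
    using sparse[OF less.prems(2)] by (intro mult_left_mono) auto
  finally have "(\<Sum>w \<in> ?N. real (card {(c, \<phi>) \<in> L v \<times> proper_colourings_on G L S. \<phi> w = c}))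
      \<le> real (card (L v)) / 2 * ?n S"
    by simp
  moreover have "real (card (L v) * card (proper_colourings_on G L S)) \<le>
      real (card (proper_colourings_on G L (insert v S)) +
      (\<Sum>w \<in> ?N. card {(c, \<phi>) \<in> L v \<times> proper_colourings_on G L S. \<phi> w = c}))"
    using less.prems finS finL by (intro of_nat_mono card_extensions_le[OF G]) auto
  ultimately show ?case
    by simp
qed

theorem theorem15:
  fixes G :: "('a, 'b) pre_digraph" and L :: "'a \<Rightarrow> 'c set"
  assumes "graph G"
    and "list_assignment G L"
    and "\<And>v. v \<in> verts G \<Longrightarrow>
      real (card (L v)) \<ge>
        4 * (\<Sum>w \<in> neighbours G v. real (card (L v \<inter> L w)) / real (card (L w)))"
  shows "real (card {\<phi> \<in> list_colourings G L. proper_colouring G \<phi>})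
    \<ge> (\<Prod>v \<in> verts G. real (card (L v)) / 2)"
proof -
  interpret graph G by (fact assms(1))
  \<comment> \<open>Stated for all vertex subsets so that vertices can be added one by one, each
    contributing its factor; the empty product 1 matches the single empty colouring.\<close>
  have "(\<Prod>v \<in> S. real (card (L v)) / 2) \<le> card (proper_colourings_on G L S)"
    if "S \<subseteq> verts G" for S
    using finite_subset[OF that finite_verts] that
  proof (induction S rule: finite_induct)
    case empty
    then show ?case
      by (simp add: proper_colourings_on_empty)
  next
    case (insert v S)
    have "(\<Prod>v \<in> insert v S. real (card (L v)) / 2)
        \<le> real (card (L v)) / 2 * card (proper_colourings_on G L S)"
      using insert by (auto intro!: mult_left_mono)
    also have "\<dots> \<le> card (proper_colourings_on G L (insert v S))"
      using insert by (intro card_proper_colourings_on_insert[OF assms]) auto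
    finally show ?case .
  qed
  then show ?thesis
    unfolding proper_colourings_on_verts[symmetric] by blast
qed

end
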